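(* Let $\hat x\in\mathbb{R}^{n^2}$ be given. The optimal solution $x^*\in\mathbb{R}^{n^2}$ of the nearest doubly stochastic matrix problem $$\min\left\{\tfrac12\|x-\hat x\|^2 \;:\; Ax=b,\ x\ge 0\right\}$$ exists and is unique. Moreover, $x^*\in\mathbb{R}^{n^2}$ solves this problem if, and only if, $$x^*=(\hat x+A^Ty^* )_+,\qquad F(y^* ):=A(\hat x+A^Ty^* )_+-b=0,\qquad\text{for some } y^*\in\mathbb{R}^{2n-1}.$$
   Context: $n\ge1$; $e$ is the all-ones vector; $A\in\mathbb{R}^{(2n-1)\times n^2}$ consists of the first $2n-1$ rows of $\begin{bmatrix} I_n\otimes e^T\\ e^T\otimes I_n\end{bmatrix}\in\mathbb{R}^{2n\times n^2}$; $b\in\mathbb{R}^{2n-1}$ is the all-ones vector. $v_+$ denotes the projection of $v$ onto the nonnegative orthant (entrywise positive part). The norm is Euclidean. *)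

theory Defs
  imports "Jordan_Normal_Form.Matrix" "HOL-Analysis.L2_Norm"
begin

definition kronecker :: "'a :: times mat \<Rightarrow> 'a mat \<Rightarrow> 'a mat" where
  "kronecker M N = mat (dim_row M * dim_row N) (dim_col M * dim_col N)
     (\<lambda>(i, j). M $$ (i div dim_row N, j div dim_col N) * N $$ (i mod dim_row N, j mod dim_col N))"

definition ones_vec :: "nat \<Rightarrow> real vec" where
  "ones_vec k = vec k (\<lambda>_. 1)"

definition vec_norm :: "real vec \<Rightarrow> real" where
  "vec_norm v = L2_set (\<lambda>i. v $ i) {..<dim_vec v}"

definition pos_vec :: "real vec \<Rightarrow> real vec" where
  "pos_vec v = map_vec (\<lambda>t. max t 0) v"

definition ds_full_mat :: "nat \<Rightarrow> real mat" where
  "ds_full_mat n = kronecker (1\<^sub>m n) (mat_of_row (ones_vec n)) @\<^sub>r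
                   kronecker (mat_of_row (ones_vec n)) (1\<^sub>m n)"

(* Writing a matrix X as the vector with x $ (n * i + j) = X_ij, the rows of ds_full_mat express
   the n row sums and then the n column sums of X; the last (redundant) one is dropped here. *)
definition ds_mat :: "nat \<Rightarrow> real mat" where
  "ds_mat n = mat_of_rows (n^2) (take (2 * n - 1) (rows (ds_full_mat n)))"

definition ds_rhs :: "nat \<Rightarrow> real vec" where
  "ds_rhs n = ones_vec (2 * n - 1)"

definition ds_feasible :: "nat \<Rightarrow> real vec \<Rightarrow> bool" where
  "ds_feasible n x \<longleftrightarrow>
     x \<in> carrier_vec (n^2) \<and> ds_mat n *\<^sub>v x = ds_rhs n \<and> 0\<^sub>v (n^2) \<le> x"

definition nearest_ds_solution :: "nat \<Rightarrow> real vec \<Rightarrow> real vec \<Rightarrow> bool" where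
  "nearest_ds_solution n xhat x \<longleftrightarrow>
     is_arg_min (\<lambda>z. 1 / 2 * (vec_norm (z - xhat))^2) (ds_feasible n) x"

definition ds_F :: "nat \<Rightarrow> real vec \<Rightarrow> real vec \<Rightarrow> real vec" where
  "ds_F n xhat y =
     ds_mat n *\<^sub>v pos_vec (xhat + transpose_mat (ds_mat n) *\<^sub>v y) - ds_rhs n"

end

theory Submission
  imports Defs "HOL-Analysis.Function_Topology"
begin

text \<open>
  Up to sign and an additive constant, the dual of the projection problem minimises the convex
  function \<open>\<theta>(y) = 1/2 * \<parallel>(xhat + A\<^sup>T y)\<^sub>+\<parallel>\<^sup>2 - b \<bullet> y\<close>, and \<open>F\<close> is its gradient. So
  everything reduces to two facts.

  \<^item> If \<open>F(y) = 0\<close>, then \<open>x = (xhat + A\<^sup>T y)\<^sub>+\<close> is feasible, and \<open>x - xhat\<close> is \<open>A\<^sup>T y\<close>, which is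
    orthogonal to differences of feasible points, plus a nonnegative vector complementary to \<open>x\<close>.
    Hence \<open>\<parallel>z - xhat\<parallel>\<^sup>2 \<ge> \<parallel>x - xhat\<parallel>\<^sup>2 + \<parallel>z - x\<parallel>\<^sup>2\<close> for all feasible \<open>z\<close> (\<open>kkt_projection_gap\<close>),
    which makes \<open>x\<close> optimal and every other feasible point worse.

  \<^item> \<open>F\<close> has a zero (\<open>multiplier_exists\<close>), because \<open>\<theta>\<close> attains its minimum. The uniform matrix
    with entries \<open>1/n\<close> is a strictly positive feasible point \<open>q\<close>, so \<open>b \<bullet> y = q \<bullet> A\<^sup>T y\<close>
    and \<open>\<theta>\<close> is coercive in \<open>A\<^sup>T y\<close>. Dropping the redundant constraint makes \<open>A\<^sup>T\<close> injective,
    so \<open>\<theta>\<close> is coercive in \<open>y\<close> as well.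

  One zero of \<open>F\<close> thus yields existence and uniqueness of the solution together, and both
  directions of the characterisation follow: any zero of \<open>F\<close> produces the unique solution, and
  the solution is the point produced by the zero that was found.
\<close>

section \<open>Scalar inequalities\<close>

text \<open>
  Coercivity of one summand of the dual function: the quadratic wins for large \<open>u\<close>, and the linear
  term wins for very negative \<open>u\<close>, where strict positivity of \<open>p\<close> is essential. The quadratic is
  bounded below by its tangent of slope \<open>2p\<close>, twice what is needed to absorb \<open>- p * u\<close>.
\<close>

lemma half_sq_pos_part_lower_bound:
  fixes c p u :: real
  assumes "p > 0"
  shows "p * \<bar>u\<bar> - (2 * p\<^sup>2 + 2 * p * \<bar>c\<bar>) \<le> (max (c + u) 0)\<^sup>2 / 2 - p * u"
proof -
  define m where "m = max (c + u) 0"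
  define d where "d = \<bar>c\<bar>"
  have m: "0 \<le> m" "c + u \<le> m" by (auto simp: m_def)
  have d: "0 \<le> d" "- d \<le> c" by (auto simp: d_def)
  have "p * \<bar>u\<bar> - (2 * p\<^sup>2 + 2 * p * d) \<le> m\<^sup>2 / 2 - p * u"
  proof (cases "u \<ge> 0")
    case True
    have "(m - 2 * p)\<^sup>2 = m\<^sup>2 - 4 * (p * m) + 4 * p\<^sup>2"
      by (simp add: power2_eq_square algebra_simps)
    then have "2 * (p * m) - 2 * p\<^sup>2 \<le> m\<^sup>2 / 2"
      using zero_le_power2[of "m - 2 * p"] by linarith
    moreover have "p * (u - d) \<le> p * m"
      using m d assms by (intro mult_left_mono) auto
    ultimately show ?thesis using True by (simp add: right_diff_distrib)
  next
    case False
    have "0 \<le> m\<^sup>2" "0 \<le> p\<^sup>2" "0 \<le> p * d" using assms d by auto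
    moreover have "p * \<bar>u\<bar> = - (p * u)" using False by simp
    ultimately show ?thesis by linarith
  qed
  then show ?thesis by (simp only: m_def d_def)
qed

text \<open>
  The function \<open>s \<mapsto> (s\<^sub>+)\<^sup>2 / 2\<close> has derivative \<open>s\<^sub>+\<close>, which is Lipschitz with constant 1. This descent
  inequality takes the place of differentiating the dual function.
\<close>

lemma half_sq_pos_part_upper_quadratic:
  fixes s t :: real
  shows "(max (s + t) 0)\<^sup>2 / 2 \<le> (max s 0)\<^sup>2 / 2 + max s 0 * t + t\<^sup>2 / 2"
proof -
  have "(max (s + t) 0)\<^sup>2 \<le> (max s 0 + t)\<^sup>2"
  proof (cases "s + t \<le> 0")
    case True
    then show ?thesis by (simp add: max_def)
  next
    case False
    then show ?thesis by (intro power_mono) auto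
  qed
  then show ?thesis by (simp add: power2_sum)
qed

text \<open>
  For small \<open>t\<close> of the sign opposite to \<open>g\<close> the linear term dominates.
\<close>

lemma slope_zero_if_quadratic_nonneg:
  fixes g s :: real
  assumes "s \<ge> 0" and "\<And>t. 0 \<le> t * g + t\<^sup>2 * s"
  shows "g = 0"
proof (rule ccontr)
  assume "g \<noteq> 0"
  \<comment> \<open>At \<open>t = - h\<close> the expression equals \<open>- h\<^sup>2\<close>.\<close>
  define h where "h = g / (s + 1)"
  have g: "g = h * (s + 1)" using assms(1) by (simp add: h_def)
  then have "h \<noteq> 0" using \<open>g \<noteq> 0\<close> by auto
  have "0 \<le> (- h) * g + (- h)\<^sup>2 * s" by (rule assms(2))
  also have "\<dots> = - h\<^sup>2" unfolding g by (simp add: power2_eq_square algebra_simps)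
  finally show False using \<open>h \<noteq> 0\<close> by simp
qed

section \<open>The dual function attains its minimum\<close>

text \<open>
  The dual function \<open>\<theta>\<close> with the term \<open>b \<bullet> y\<close> rewritten as \<open>p \<bullet> A\<^sup>T y\<close> for a point \<open>p\<close> satisfying
  \<open>A p = b\<close>, so that it splits into one scalar function per component of \<open>A\<^sup>T y\<close>. The multiplier is a
  function on all naturals, with the entries from \<open>m\<close> on ignored, so that the product topology
  provides compact boxes for every \<open>m\<close>.
\<close>

definition dual_objective ::
    "(nat \<Rightarrow> nat \<Rightarrow> real) \<Rightarrow> (nat \<Rightarrow> real) \<Rightarrow> (nat \<Rightarrow> real) \<Rightarrow> nat \<Rightarrow> nat \<Rightarrow> (nat \<Rightarrow> real) \<Rightarrow> real"
  where
  "dual_objective a c p m N y =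
     (\<Sum>j<N. (max (c j + (\<Sum>k<m. a k j * y k)) 0)\<^sup>2 / 2 - p j * (\<Sum>k<m. a k j * y k))"

lemma dual_objective_zero_nonneg: "0 \<le> dual_objective a c p m N (\<lambda>_. 0)"
  by (simp add: dual_objective_def sum_nonneg)

text \<open>
  Summing the scalar bounds gives \<open>(\<Sum>i. p i * \<bar>u i\<bar>) \<le> M\<close> on the sublevel set of the origin, hence
  \<open>\<bar>u j\<bar> \<le> M / p j\<close>; the sum over \<open>i\<close> is just a bound that is uniform in \<open>j\<close>.
\<close>

lemma dual_objective_sublevel_bounded:
  assumes p: "\<And>j. j < N \<Longrightarrow> p j > 0"
    and sub: "dual_objective a c p m N y \<le> dual_objective a c p m N (\<lambda>_. 0)"
    and j: "j < N"
  shows "\<bar>\<Sum>k<m. a k j * y k\<bar> \<le>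
    (\<Sum>i<N. (dual_objective a c p m N (\<lambda>_. 0) + (\<Sum>i<N. 2 * (p i)\<^sup>2 + 2 * p i * \<bar>c i\<bar>)) / p i)"
    (is "_ \<le> (\<Sum>i<N. ?M / p i)")
proof -
  let ?u = "\<lambda>j. \<Sum>k<m. a k j * y k"
  have D: "0 \<le> (\<Sum>i<N. 2 * (p i)\<^sup>2 + 2 * p i * \<bar>c i\<bar>)"
    using p by (intro sum_nonneg add_nonneg_nonneg mult_nonneg_nonneg)
      (simp_all add: less_imp_le)
  have M: "0 \<le> ?M" using D dual_objective_zero_nonneg[of a c p m N] by simp
  have "(\<Sum>i<N. p i * \<bar>?u i\<bar> - (2 * (p i)\<^sup>2 + 2 * p i * \<bar>c i\<bar>)) \<le> dual_objective a c p m N y"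
    unfolding dual_objective_def by (intro sum_mono half_sq_pos_part_lower_bound p) simp
  then have total: "(\<Sum>i<N. p i * \<bar>?u i\<bar>) \<le> ?M"
    using sub by (simp add: sum_subtractf)
  have "p j * \<bar>?u j\<bar> \<le> (\<Sum>i<N. p i * \<bar>?u i\<bar>)"
    using j p by (intro member_le_sum mult_nonneg_nonneg) (simp_all add: less_imp_le)
  with total have "\<bar>?u j\<bar> \<le> ?M / p j"
    using p[OF j] by (simp add: pos_le_divide_eq mult.commute)
  also have "\<dots> \<le> (\<Sum>i<N. ?M / p i)"
    using j p M by (intro member_le_sum) (auto intro!: divide_nonneg_pos)
  finally show ?thesis .
qed

lemma dual_objective_continuous: "continuous_on UNIV (dual_objective a c p m N)"
  unfolding dual_objective_def[abs_def]
  by (intro continuous_intros continuous_on_product_coordinates) auto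

text \<open>
  The hypothesis with the constant \<open>L\<close> is injectivity of \<open>A\<^sup>T\<close> in quantitative form. It turns the
  bound on \<open>A\<^sup>T y\<close> over the sublevel set into a bound on \<open>y\<close>, so that minimising over a compact box
  suffices.
\<close>

lemma dual_objective_attains_min:
  assumes p: "\<And>j. j < N \<Longrightarrow> p j > 0"
    and inj: "\<And>y R k. \<lbrakk>\<And>j. j < N \<Longrightarrow> \<bar>\<Sum>k<m. a k j * y k\<bar> \<le> R; k < m\<rbrakk> \<Longrightarrow> \<bar>y k\<bar> \<le> L * R"
  obtains y where "\<And>z. dual_objective a c p m N y \<le> dual_objective a c p m N z"
proof -
  let ?\<theta> = "dual_objective a c p m N"
  define R where
    "R = (\<Sum>i<N. (?\<theta> (\<lambda>_. 0) + (\<Sum>i<N. 2 * (p i)\<^sup>2 + 2 * p i * \<bar>c i\<bar>)) / p i)"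
  \<comment> \<open>The box has to contain the origin, whatever the sign of \<open>L\<close>.\<close>
  define B where "B = max 0 (L * R)"
  define K where "K = PiE UNIV (\<lambda>k. if k < m then {-B..B} else {0::real})"
  have "compactin (product_topology (\<lambda>_. euclidean) UNIV) K"
    unfolding K_def by (subst compactin_PiE) auto
  then have "compact K" by (simp add: euclidean_product_topology)
  moreover have zero_in: "(\<lambda>_. 0) \<in> K" by (auto simp: K_def B_def)
  ultimately obtain y where y: "y \<in> K" "\<And>z. z \<in> K \<Longrightarrow> ?\<theta> y \<le> ?\<theta> z"
    using continuous_attains_inf[of K ?\<theta>] dual_objective_continuous continuous_on_subset
    by (metis empty_iff top_greatest)
  have "?\<theta> y \<le> ?\<theta> z" for z
  proof (cases "?\<theta> z \<le> ?\<theta> (\<lambda>_. 0)")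
    case True
    \<comment> \<open>Clearing the ignored entries moves the point into the box at the same value.\<close>
    let ?z = "\<lambda>k. if k < m then z k else 0"
    have "\<bar>z k\<bar> \<le> L * R" if "k < m" for k
      using that dual_objective_sublevel_bounded[OF p True] unfolding R_def by (intro inj) auto
    then have "?z \<in> K"
      by (fastforce simp: K_def B_def)
    moreover have "?\<theta> ?z = ?\<theta> z" by (simp add: dual_objective_def)
    ultimately show ?thesis using y(2) by metis
  next
    case False
    then show ?thesis using y(2)[OF zero_in] by simp
  qed
  then show ?thesis using that by blast
qed

text \<open>
  The equation says that the partial derivative in direction \<open>k\<close> vanishes. Moving \<open>y\<close> by \<open>t\<close> along that
  coordinate changes the dual function by at most \<open>t\<close> times this derivative plus a multiple of
  \<open>t\<^sup>2\<close>, and the change cannot be negative.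
\<close>

lemma dual_minimizer_stationary:
  assumes min: "\<And>z. dual_objective a c p m N y \<le> dual_objective a c p m N z"
    and k: "k < m"
  shows "(\<Sum>j<N. a k j * max (c j + (\<Sum>k<m. a k j * y k)) 0) = (\<Sum>j<N. a k j * p j)"
proof -
  let ?u = "\<lambda>j. \<Sum>k<m. a k j * y k"
  let ?x = "\<lambda>j. max (c j + ?u j) 0"
  let ?g = "\<Sum>j<N. a k j * (?x j - p j)"
  have "0 \<le> t * ?g + t\<^sup>2 * (\<Sum>j<N. (a k j)\<^sup>2 / 2)" for t
  proof -
    let ?z = "y(k := y k + t)"
    have shift: "(\<Sum>i<m. a i j * ?z i) = ?u j + t * a k j" for j
    proof -
      have "(\<Sum>i<m. a i j * ?z i) = (\<Sum>i<m. a i j * y i + (if i = k then t * a k j else 0))"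
        by (intro sum.cong) (auto simp: algebra_simps)
      then show ?thesis using k by (simp add: sum.distrib)
    qed
    have "dual_objective a c p m N ?z - dual_objective a c p m N y
        = (\<Sum>j<N. (max (c j + ?u j + t * a k j) 0)\<^sup>2 / 2 - (?x j)\<^sup>2 / 2 - p j * (t * a k j))"
      unfolding dual_objective_def shift sum_subtractf[symmetric]
      by (intro sum.cong) (auto simp: algebra_simps)
    also have "\<dots> \<le> (\<Sum>j<N. t * (a k j * (?x j - p j)) + t\<^sup>2 * ((a k j)\<^sup>2 / 2))"
    proof (intro sum_mono)
      fix j
      show "(max (c j + ?u j + t * a k j) 0)\<^sup>2 / 2 - (?x j)\<^sup>2 / 2 - p j * (t * a k j)
          \<le> t * (a k j * (?x j - p j)) + t\<^sup>2 * ((a k j)\<^sup>2 / 2)"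
        using half_sq_pos_part_upper_quadratic[of "c j + ?u j" "t * a k j"]
        by (simp add: algebra_simps power_mult_distrib)
    qed
    also have "\<dots> = t * ?g + t\<^sup>2 * (\<Sum>j<N. (a k j)\<^sup>2 / 2)"
      by (simp only: sum.distrib sum_distrib_left)
    finally show ?thesis using min[of ?z] by linarith
  qed
  then have "?g = 0"
    by (intro slope_zero_if_quadratic_nonneg[of "\<Sum>j<N. (a k j)\<^sup>2 / 2"]) (auto intro: sum_nonneg)
  then show ?thesis by (simp add: right_diff_distrib sum_subtractf)
qed

text \<open>
  A Slater point \<open>q\<close> and full row rank of \<open>A\<close> guarantee Lagrange multipliers for the projection
  of \<open>c\<close> onto the nonnegative solutions of \<open>A x = A q\<close>.
\<close>

lemma multiplier_exists:
  assumes A: "A \<in> carrier_mat m N" and c: "c \<in> carrier_vec N" and q: "q \<in> carrier_vec N"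
    and pos: "\<And>j. j < N \<Longrightarrow> q $ j > 0"
    and inj: "\<And>y R k. \<lbrakk>\<And>j. j < N \<Longrightarrow> \<bar>\<Sum>k<m. A $$ (k, j) * y k\<bar> \<le> R; k < m\<rbrakk>
                \<Longrightarrow> \<bar>y k\<bar> \<le> L * R"
  shows "\<exists>y \<in> carrier_vec m. A *\<^sub>v pos_vec (c + transpose_mat A *\<^sub>v y) = A *\<^sub>v q"
proof -
  obtain y where y: "\<And>z. dual_objective (\<lambda>k j. A $$ (k, j)) (($) c) (($) q) m N y
      \<le> dual_objective (\<lambda>k j. A $$ (k, j)) (($) c) (($) q) m N z"
  proof (rule dual_objective_attains_min[where a = "\<lambda>k j. A $$ (k, j)" and p = "($) q"
        and c = "($) c" and m = m and N = N and L = L])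
    show "\<bar>y k\<bar> \<le> L * R"
      if "\<And>j. j < N \<Longrightarrow> \<bar>\<Sum>k<m. A $$ (k, j) * y k\<bar> \<le> R" "k < m" for y R k
      using inj[OF that] .
  qed (use pos in auto)
  have "A *\<^sub>v pos_vec (c + transpose_mat A *\<^sub>v vec m y) = A *\<^sub>v q"
  proof (rule eq_vecI)
    fix k assume "k < dim_vec (A *\<^sub>v q)"
    then have k: "k < m" using A by simp
    have "(\<Sum>j<N. A $$ (k, j) * max (c $ j + (\<Sum>k<m. A $$ (k, j) * y k)) 0)
        = (\<Sum>j<N. A $$ (k, j) * q $ j)"
      by (rule dual_minimizer_stationary[OF y k])
    then show "(A *\<^sub>v pos_vec (c + transpose_mat A *\<^sub>v vec m y)) $ k = (A *\<^sub>v q) $ k"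
      using A c q k by (simp add: scalar_prod_def pos_vec_def lessThan_atLeast0)
  qed (use A in simp)
  then show ?thesis by (intro bexI[of _ "vec m y"]) auto
qed

section \<open>Sufficiency of the optimality conditions\<close>

lemma vec_norm_sq: "(vec_norm v)\<^sup>2 = (\<Sum>i<dim_vec v. (v $ i)\<^sup>2)"
  by (simp add: vec_norm_def L2_set_def sum_nonneg)

text \<open>
  Expanding the square, the gap is twice \<open>(z - x) \<bullet> (x - c)\<close>. With \<open>w = A\<^sup>T y\<close>, the vector \<open>w\<close> is orthogonal to
  \<open>z - x\<close>, and \<open>x - c - w\<close>, the negative part of \<open>c + w\<close>, is nonnegative and vanishes where \<open>x\<close> is
  positive, so its inner product with \<open>z - x\<close> is its inner product with \<open>z\<close>, which is nonnegative.
\<close>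

lemma kkt_projection_gap:
  assumes A: "A \<in> carrier_mat m N" and c: "c \<in> carrier_vec N" and y: "y \<in> carrier_vec m"
    and x: "x = pos_vec (c + transpose_mat A *\<^sub>v y)"
    and z: "z \<in> carrier_vec N" "0\<^sub>v N \<le> z" and eq: "A *\<^sub>v z = A *\<^sub>v x"
  shows "(vec_norm (x - c))\<^sup>2 + (vec_norm (z - x))\<^sup>2 \<le> (vec_norm (z - c))\<^sup>2"
proof -
  define w where "w = transpose_mat A *\<^sub>v y"
  have w: "w \<in> carrier_vec N" using A y by (simp add: w_def)
  have xc: "x \<in> carrier_vec N" using w c by (auto simp: x w_def[symmetric] pos_vec_def)
  have xj: "x $ j = max (c $ j + w $ j) 0" if "j < N" for j
    using that w c by (simp add: x w_def[symmetric] pos_vec_def)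
  have "w \<bullet> (z - x) = y \<bullet> (A *\<^sub>v (z - x))"
    unfolding w_def using A y z(1) xc by (intro transpose_vec_mult_scalar) auto
  also have "A *\<^sub>v (z - x) = 0\<^sub>v m"
    using A z(1) xc eq by (simp add: mult_minus_distrib_mat_vec)
  finally have orth: "(\<Sum>j<N. w $ j * (z $ j - x $ j)) = 0"
    using y z(1) xc by (simp add: scalar_prod_def lessThan_atLeast0)
  have "(\<Sum>j<N. (x $ j - c $ j)\<^sup>2 + (z $ j - x $ j)\<^sup>2 + 2 * (w $ j * (z $ j - x $ j)))
      \<le> (\<Sum>j<N. (z $ j - c $ j)\<^sup>2)"
  proof (intro sum_mono)
    fix j assume "j \<in> {..<N}"
    then have j: "j < N" by simp
    have zj: "0 \<le> z $ j" using z j by (auto simp: less_eq_vec_def)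
    have "0 \<le> (z $ j - x $ j) * (x $ j - c $ j - w $ j)"
      using zj unfolding xj[OF j] by (auto simp: max_def intro!: mult_nonneg_nonneg)
    then show "(x $ j - c $ j)\<^sup>2 + (z $ j - x $ j)\<^sup>2 + 2 * (w $ j * (z $ j - x $ j))
        \<le> (z $ j - c $ j)\<^sup>2"
      by (simp add: power2_eq_square algebra_simps)
  qed
  then show ?thesis
    using orth z(1) xc c by (simp add: vec_norm_sq sum.distrib flip: sum_distrib_left)
qed

section \<open>The constraint matrix of doubly stochastic matrices\<close>

lemma ds_full_mat_carrier: "ds_full_mat n \<in> carrier_mat (n + n) (n\<^sup>2)"
  unfolding ds_full_mat_def
  by (rule carrier_append_rows) (auto simp: kronecker_def ones_vec_def power2_eq_square)

lemma ds_full_mat_index: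
  assumes k: "k < n + n" and j: "j < n\<^sup>2"
  shows "ds_full_mat n $$ (k, j) =
    (if k < n then if j div n = k then 1 else 0 else if j mod n = k - n then 1 else 0)"
proof -
  have n: "0 < n" using j by (cases n) auto
  have jj: "j < n * n" using j by (simp add: power2_eq_square)
  have jd: "j div n < n" using jj by (simp add: less_mult_imp_div_less)
  show ?thesis
    using k n jd jj
    by (auto simp: ds_full_mat_def kronecker_def append_rows_def ones_vec_def mat_of_row_def)
qed

lemma ds_mat_carrier: "ds_mat n \<in> carrier_mat (2 * n - 1) (n\<^sup>2)"
  using ds_full_mat_carrier[of n] by (auto simp: ds_mat_def)

lemma ds_mat_index:
  assumes k: "k < 2 * n - 1" and j: "j < n\<^sup>2"
  shows "ds_mat n $$ (k, j) =
    (if k < n then if j div n = k then 1 else 0 else if j mod n = k - n then 1 else 0)"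
proof -
  have "ds_mat n $$ (k, j) = ds_full_mat n $$ (k, j)"
    using k j ds_full_mat_carrier[of n] by (simp add: ds_mat_def mat_of_rows_index)
  then show ?thesis using ds_full_mat_index[of k n j] k j by simp
qed

lemma block_row_index:
  fixes n i j :: nat
  assumes "i < n" "j < n"
  shows "n * i + j < n\<^sup>2" "(n * i + j) div n = i" "(n * i + j) mod n = j"
proof -
  have "n * i + j < n * Suc i" using assms by simp
  also have "\<dots> \<le> n * n" using assms by (intro mult_left_mono) auto
  finally show "n * i + j < n\<^sup>2" by (simp add: power2_eq_square)
qed (use assms in auto)

text \<open>
  The uniform matrix is the Slater point: every row of the constraint matrix selects \<open>n\<close> entries.
\<close>

lemma ds_mat_uniform:
  assumes n: "n \<ge> 1"
  shows "ds_mat n *\<^sub>v vec (n\<^sup>2) (\<lambda>_. 1 / real n) = ds_rhs n"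
proof (rule eq_vecI)
  fix k assume "k < dim_vec (ds_rhs n)"
  then have k: "k < 2 * n - 1" by (simp add: ds_rhs_def ones_vec_def)
  define S where "S = {j \<in> {..<n\<^sup>2}. if k < n then j div n = k else j mod n = k - n}"
  have "card S = n"
  proof (cases "k < n")
    case True
    have "S = (\<lambda>i. n * k + i) ` {..<n}"
    proof (intro subset_antisym subsetI)
      fix j assume "j \<in> S"
      then have q: "j div n = k" and r: "j mod n < n" using True n by (auto simp: S_def)
      have "j = n * k + j mod n" using mult_div_mod_eq[of n j] unfolding q by (rule sym)
      with r
      show "j \<in> (\<lambda>i. n * k + i) ` {..<n}" by blast
    qed (use True in \<open>auto simp: S_def block_row_index\<close>)
    then show ?thesis by (simp add: card_image)
  next
    case False
    have "S = (\<lambda>i. n * i + (k - n)) ` {..<n}"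
    proof (intro subset_antisym subsetI)
      fix j assume "j \<in> S"
      then have r: "j mod n = k - n" and q: "j div n < n"
        using False by (auto simp: S_def power2_eq_square less_mult_imp_div_less)
      have "j = n * (j div n) + (k - n)" using mult_div_mod_eq[of n j] unfolding r by (rule sym)
      with q
      show "j \<in> (\<lambda>i. n * i + (k - n)) ` {..<n}" by blast
    next
      fix j assume "j \<in> (\<lambda>i. n * i + (k - n)) ` {..<n}"
      then obtain i where i: "i < n" "j = n * i + (k - n)" by auto
      have "k - n < n" using k False by linarith
      from block_row_index[OF i(1) this] show "j \<in> S"
        using False i(2) by (simp add: S_def)
    qed
    moreover have "inj_on (\<lambda>i. n * i + (k - n)) {..<n}" using n by (auto simp: inj_on_def)
    ultimately show ?thesis by (simp add: card_image)
  qed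
  have "(ds_mat n *\<^sub>v vec (n\<^sup>2) (\<lambda>_. 1 / real n)) $ k
      = (\<Sum>j<n\<^sup>2. ds_mat n $$ (k, j) * (1 / real n))"
    using ds_mat_carrier[of n] k by (simp add: scalar_prod_def lessThan_atLeast0)
  also have "\<dots> = (\<Sum>j<n\<^sup>2. if (if k < n then j div n = k else j mod n = k - n) then 1 / real n else 0)"
    using k by (intro sum.cong) (auto simp: ds_mat_index)
  also have "\<dots> = (\<Sum>j\<in>S. 1 / real n)"
    unfolding S_def by (rule sum.inter_filter[symmetric]) simp
  also have "\<dots> = 1" using \<open>card S = n\<close> n by simp
  finally show "(ds_mat n *\<^sub>v vec (n\<^sup>2) (\<lambda>_. 1 / real n)) $ k = ds_rhs n $ k"
    using k by (simp add: ds_rhs_def ones_vec_def)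
qed (use ds_mat_carrier[of n] in \<open>auto simp: ds_rhs_def ones_vec_def\<close>)

text \<open>
  In matrix form, \<open>A\<^sup>T y\<close> has the entry \<open>\<alpha>\<^sub>i + \<beta>\<^sub>j\<close> at position \<open>(i, j)\<close>, where \<open>\<alpha>\<close> and \<open>\<beta>\<close> are the multipliers
  of the row sums and of the column sums, and \<open>\<beta>\<close> is zero at the dropped last column.
\<close>

lemma ds_mat_transpose_entry:
  assumes i: "i < n" and j: "j < n"
  shows "(\<Sum>k<2 * n - 1. ds_mat n $$ (k, n * i + j) * y k)
    = y i + (if j < n - 1 then y (n + j) else 0)"
proof -
  have "(\<Sum>k<2 * n - 1. ds_mat n $$ (k, n * i + j) * y k)
      = (\<Sum>k<2 * n - 1. (if k = i then y i else 0) + (if k = n + j then y (n + j) else 0))"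
    using i j by (intro sum.cong) (auto simp: ds_mat_index block_row_index)
  also have "\<dots> = y i + (if j < n - 1 then y (n + j) else 0)"
    using i j by (auto simp: sum.distrib)
  finally show ?thesis .
qed

text \<open>
  The last column of \<open>A\<^sup>T y\<close>, read as a matrix, is \<open>\<alpha>\<close> itself, and its first row minus \<open>\<alpha>\<^sub>0\<close> is \<open>\<beta>\<close>;
  the subtraction is the source of the factor 2.
\<close>

lemma ds_mat_transpose_bounded_below:
  assumes bound: "\<And>j. j < n\<^sup>2 \<Longrightarrow> \<bar>\<Sum>k<2 * n - 1. ds_mat n $$ (k, j) * y k\<bar> \<le> R"
    and k: "k < 2 * n - 1"
  shows "\<bar>y k\<bar> \<le> 2 * R"
proof -
  have entry: "\<bar>y i + (if j < n - 1 then y (n + j) else 0)\<bar> \<le> R" if "i < n" "j < n" for i j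
    using bound[OF block_row_index(1)[OF that]] ds_mat_transpose_entry[OF that] by simp
  have row: "\<bar>y i\<bar> \<le> R" if "i < n" for i
    using entry[OF that, of "n - 1"] that by simp
  show ?thesis
  proof (cases "k < n")
    case True
    then show ?thesis using row[OF True] by linarith
  next
    case False
    then have "k - n < n" "k - n < n - 1" "n + (k - n) = k" "0 < n" using k by linarith+
    then have "\<bar>y 0 + y k\<bar> \<le> R" "\<bar>y 0\<bar> \<le> R" using entry[of 0 "k - n"] row[of 0] by simp_all
    then show ?thesis by linarith
  qed
qed

section \<open>Nearest doubly stochastic matrices\<close>

lemma ds_F_zero_iff:
  assumes "xhat \<in> carrier_vec (n\<^sup>2)"
  shows "ds_F n xhat y = 0\<^sub>v (2 * n - 1) \<longleftrightarrow>
    ds_mat n *\<^sub>v pos_vec (xhat + transpose_mat (ds_mat n) *\<^sub>v y) = ds_rhs n" (is "_ \<longleftrightarrow> ?v = _")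
proof
  have d: "dim_vec ?v = 2 * n - 1" "dim_vec (ds_rhs n) = 2 * n - 1"
    using ds_mat_carrier[of n] by (auto simp: ds_rhs_def ones_vec_def)
  assume z: "ds_F n xhat y = 0\<^sub>v (2 * n - 1)"
  show "?v = ds_rhs n"
  proof (rule eq_vecI)
    fix i assume "i < dim_vec (ds_rhs n)"
    moreover have "(?v - ds_rhs n) $ i = 0\<^sub>v (2 * n - 1) $ i" using z by (simp add: ds_F_def)
    ultimately show "?v $ i = ds_rhs n $ i" using d by simp
  qed (use d in simp)
next
  assume "?v = ds_rhs n"
  then show "ds_F n xhat y = 0\<^sub>v (2 * n - 1)"
    by (simp add: ds_F_def ds_rhs_def ones_vec_def minus_cancel_vec)
qed

text \<open>
  A single zero of \<open>F\<close> settles optimality and uniqueness at once, since the gap inequality leaves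
  room for a second minimiser only at distance zero.
\<close>

lemma nearest_ds_solution_iff_kkt_point:
  assumes xhat: "xhat \<in> carrier_vec (n\<^sup>2)" and y: "y \<in> carrier_vec (2 * n - 1)"
    and x: "x = pos_vec (xhat + transpose_mat (ds_mat n) *\<^sub>v y)"
    and F: "ds_F n xhat y = 0\<^sub>v (2 * n - 1)"
  shows "nearest_ds_solution n xhat z \<longleftrightarrow> z = x"
proof -
  note A = ds_mat_carrier[of n]
  have xc: "x \<in> carrier_vec (n\<^sup>2)"
    using A xhat y by (simp add: x pos_vec_def)
  have Ax: "ds_mat n *\<^sub>v x = ds_rhs n" using F ds_F_zero_iff[OF xhat] by (simp add: x)
  have "0\<^sub>v (n\<^sup>2) \<le> x"
    using xhat A by (auto simp: less_eq_vec_def x pos_vec_def)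
  then have feas: "ds_feasible n x" using xc Ax by (simp add: ds_feasible_def)
  have gap: "(vec_norm (x - xhat))\<^sup>2 + (vec_norm (v - x))\<^sup>2 \<le> (vec_norm (v - xhat))\<^sup>2"
    if "ds_feasible n v" for v
    using that Ax by (intro kkt_projection_gap[OF A xhat y x]) (auto simp: ds_feasible_def)
  have "nearest_ds_solution n xhat x"
    unfolding nearest_ds_solution_def is_arg_min_linorder
  proof (intro conjI allI impI feas)
    fix v assume "ds_feasible n v"
    from gap[OF this] have "(vec_norm (x - xhat))\<^sup>2 \<le> (vec_norm (v - xhat))\<^sup>2"
      using zero_le_power2[of "vec_norm (v - x)"] by linarith
    then show "1 / 2 * (vec_norm (x - xhat))\<^sup>2 \<le> 1 / 2 * (vec_norm (v - xhat))\<^sup>2" by simp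
  qed
  moreover have "z = x" if sol: "nearest_ds_solution n xhat z"
  proof -
    have zf: "ds_feasible n z" and "(vec_norm (z - xhat))\<^sup>2 \<le> (vec_norm (x - xhat))\<^sup>2"
      using sol feas unfolding nearest_ds_solution_def is_arg_min_linorder by auto
    with gap[OF zf] have "(vec_norm (z - x))\<^sup>2 \<le> 0" by linarith
    then have "\<forall>i<n\<^sup>2. (z - x) $ i = 0"
      using xc by (simp add: vec_norm_def L2_set_eq_0_iff)
    then show "z = x" using zf xc by (intro eq_vecI) (auto simp: ds_feasible_def)
  qed
  ultimately show ?thesis by blast
qed

theorem theorem1p1:
  fixes n :: nat and xhat :: "real vec"
  assumes "n \<ge> 1"
    and "xhat \<in> carrier_vec (n^2)"
  shows "(\<exists>!x. nearest_ds_solution n xhat x) \<and>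
    (\<forall>x \<in> carrier_vec (n^2).
       nearest_ds_solution n xhat x \<longleftrightarrow>
       (\<exists>y \<in> carrier_vec (2 * n - 1).
          x = pos_vec (xhat + transpose_mat (ds_mat n) *\<^sub>v y) \<and>
          ds_F n xhat y = 0\<^sub>v (2 * n - 1)))"
proof -
  have "\<exists>y \<in> carrier_vec (2 * n - 1).
      ds_mat n *\<^sub>v pos_vec (xhat + transpose_mat (ds_mat n) *\<^sub>v y)
        = ds_mat n *\<^sub>v vec (n\<^sup>2) (\<lambda>_. 1 / real n)"
  proof (rule multiplier_exists[OF ds_mat_carrier assms(2)])
    show "\<bar>y k\<bar> \<le> 2 * R"
      if "\<And>j. j < n\<^sup>2 \<Longrightarrow> \<bar>\<Sum>k<2 * n - 1. ds_mat n $$ (k, j) * y k\<bar> \<le> R" "k < 2 * n - 1"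
      for y R k
      using ds_mat_transpose_bounded_below[OF that] .
  qed (use assms(1) in auto)
  then obtain y where y: "y \<in> carrier_vec (2 * n - 1)" "ds_F n xhat y = 0\<^sub>v (2 * n - 1)"
    using ds_F_zero_iff[OF assms(2)] ds_mat_uniform[OF assms(1)] by auto
  note kkt = nearest_ds_solution_iff_kkt_point[OF assms(2)]
  have "\<exists>!x. nearest_ds_solution n xhat x"
    using kkt[OF y(1) refl y(2)] by simp
  moreover have "nearest_ds_solution n xhat x \<longleftrightarrow>
       (\<exists>y \<in> carrier_vec (2 * n - 1).
          x = pos_vec (xhat + transpose_mat (ds_mat n) *\<^sub>v y) \<and>
          ds_F n xhat y = 0\<^sub>v (2 * n - 1))" for x
    using kkt y by blast
  ultimately show ?thesis by blast
qed

end
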